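(* Let $(V,\nu,\tau,\tau^* )$ be a PN space in which $\tau$ and $\tau^*$ are sup-continuous, let $W$ be a linear subspace of $V$ that is closed in the strong topology, regarded as the PN space $(W,\nu',\tau,\tau^* )$ with $\nu'$ the restriction of $\nu$ to $W$, and let $(V/\!\sim_W,\bar\nu,\tau,\tau^* )$ be the quotient space of $V$ with respect to $W$. If any two of the three spaces $V$, $W$ and $V/\!\sim_W$ are strongly complete, then so is the third.
   Context: Linear spaces are real. $\Delta^+$ is the set of functions $F:\mathbb{R}\cup\{-\infty,+\infty\}\to[0,1]$ that are non-decreasing, left-continuous on $\mathbb{R}$, with $F(-\infty)=F(0)=0$ and $F(+\infty)=1$; it is ordered pointwise. $\varepsilon_0\in\Delta^+$ is given by $\varepsilon_0(x)=0$ for $x\le 0$ and $\varepsilon_0(x)=1$ for $x>0$. $\Delta^+$ carries the Sibley metric $d_S(F,G)=\inf\{h>0: (F,G;h)\text{ and }(G,F;h)\text{ hold}\}$, where, for $h\in(0,1]$, $(F,G;h)$ is the condition $F(x-h)-h\le G(x)\le F(x+h)+h$ for all $x\in(-1/h,1/h)$. A triangle function is an associative, commutative binary operation on $\Delta^+$, non-decreasing in each place, with identity $\varepsilon_0$; its continuity is with respect to $d_S$. A triangle function $\tau$ is sup-continuous if for every family $\{F_\lambda\}_{\lambda\in\Lambda}$ in $\Delta^+$ and every $G\in\Delta^+$, $\sup_\lambda\tau(F_\lambda,G)=\tau(\sup_\lambda F_\lambda,G)$ (pointwise suprema). A probabilistic normed (PN) space is a quadruple $(V,\nu,\tau,\tau^*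 )$ where $V$ is a linear space, $\tau,\tau^*$ are continuous triangle functions with $\tau\le\tau^*$, and $\nu:V\to\Delta^+$, $p\mapsto\nu_p$, satisfies: (N1) $\nu_p=\varepsilon_0$ iff $p=\theta$ (the null vector); (N2) $\nu_{-p}=\nu_p$; (N3) $\nu_{p+q}\ge\tau(\nu_p,\nu_q)$; (N4) $\nu_p\le\tau^*(\nu_{\alpha p},\nu_{(1-\alpha)p})$ for every $\alpha\in[0,1]$; for all $p,q\in V$. The strong topology on $V$ is determined by the neighbourhoods $N_p(t)=\{q\in V:\nu_{q-p}(t)>1-t\}=\{q\in V: d_S(\nu_{q-p},\varepsilon_0)<t\}$, $t>0$. A sequence $(p_n)$ is strongly convergent to $p$ if for each $\lambda>0$ there is $N$ with $p_n\in N_p(\lambda)$ for $n\ge N$; it is strong Cauchy if for each $\lambda>0$ there is $N$ with $\nu_{p_n-p_m}(\lambda)>1-\lambda$ whenever $m,n>N$. A PN space is strongly complete if every strong Cauchy sequence in it is strongly convergent to a point of it. Quotient: for a linear subspace $W$, $V/\!\sim_W$ is the quotient by $p\sim_W q\Leftrightarrow p-q\in W$, and $\bar\nu_{p+W}(x)=\sup_{q\in W}\nu_{p+q}(x)$. *)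

theory Defs
  imports "HOL-Analysis.Analysis" "HOL-Algebra.Algebraic_Closure_Type"
begin

section \<open>Distance distribution functions\<close>

text \<open>The set \<open>\<Delta>\<^sup>+\<close>; the order is the pointwise order of HOL's function space.\<close>

definition ddf :: "(ereal \<Rightarrow> real) set" where
  "ddf = {F. range F \<subseteq> {0..1} \<and> mono F \<and>
             (\<forall>x::real. continuous (at_left x) (\<lambda>y. F (ereal y))) \<and>
             F (-\<infinity>) = 0 \<and> F 0 = 0 \<and> F \<infinity> = 1}"

definition eps0 :: "ereal \<Rightarrow> real" where
  "eps0 x = (if x \<le> 0 then 0 else 1)"

definition sibley_cond :: "(ereal \<Rightarrow> real) \<Rightarrow> (ereal \<Rightarrow> real) \<Rightarrow> real \<Rightarrow> bool" where
  "sibley_cond F G h \<longleftrightarrow>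
     (\<forall>x\<in>{-1/h<..<1/h}. F (ereal (x - h)) - h \<le> G (ereal x) \<and>
                         G (ereal x) \<le> F (ereal (x + h)) + h)"

definition sibley_dist :: "(ereal \<Rightarrow> real) \<Rightarrow> (ereal \<Rightarrow> real) \<Rightarrow> real" where
  "sibley_dist F G = Inf {h. 0 < h \<and> h \<le> 1 \<and> sibley_cond F G h \<and> sibley_cond G F h}"

text \<open>Pointwise suprema, for nonempty families (for which the real suprema are meaningful).\<close>

definition ddf_Sup :: "(ereal \<Rightarrow> real) set \<Rightarrow> ereal \<Rightarrow> real" where
  "ddf_Sup \<F> x = (SUP F\<in>\<F>. F x)"


section \<open>Triangle functions\<close>

definition triangle_function ::
    "((ereal \<Rightarrow> real) \<Rightarrow> (ereal \<Rightarrow> real) \<Rightarrow> (ereal \<Rightarrow> real)) \<Rightarrow> bool" where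
  "triangle_function \<tau> \<longleftrightarrow>
     (\<forall>F\<in>ddf. \<forall>G\<in>ddf. \<tau> F G \<in> ddf) \<and>
     (\<forall>F\<in>ddf. \<forall>G\<in>ddf. \<forall>H\<in>ddf. \<tau> (\<tau> F G) H = \<tau> F (\<tau> G H)) \<and>
     (\<forall>F\<in>ddf. \<forall>G\<in>ddf. \<tau> F G = \<tau> G F) \<and>
     (\<forall>F\<in>ddf. \<forall>F'\<in>ddf. \<forall>G\<in>ddf. F \<le> F' \<longrightarrow> \<tau> F G \<le> \<tau> F' G \<and> \<tau> G F \<le> \<tau> G F') \<and>
     (\<forall>F\<in>ddf. \<tau> F eps0 = F)"

definition continuous_tf ::
    "((ereal \<Rightarrow> real) \<Rightarrow> (ereal \<Rightarrow> real) \<Rightarrow> (ereal \<Rightarrow> real)) \<Rightarrow> bool" where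
  "continuous_tf \<tau> \<longleftrightarrow>
     (\<forall>F\<in>ddf. \<forall>G\<in>ddf. \<forall>e>0. \<exists>d>0. \<forall>F'\<in>ddf. \<forall>G'\<in>ddf.
        sibley_dist F F' < d \<and> sibley_dist G G' < d \<longrightarrow>
        sibley_dist (\<tau> F G) (\<tau> F' G') < e)"

text \<open>Both suprema depend only on the set of members of a family, so quantifying over nonempty
  subsets of \<open>\<Delta>\<^sup>+\<close> covers families over index sets of any type.\<close>

definition sup_continuous_tf ::
    "((ereal \<Rightarrow> real) \<Rightarrow> (ereal \<Rightarrow> real) \<Rightarrow> (ereal \<Rightarrow> real)) \<Rightarrow> bool" where
  "sup_continuous_tf \<tau> \<longleftrightarrow>
     (\<forall>\<F> G. \<F> \<subseteq> ddf \<and> \<F> \<noteq> {} \<and> G \<in> ddf \<longrightarrow>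
        ddf_Sup ((\<lambda>F. \<tau> F G) ` \<F>) = \<tau> (ddf_Sup \<F>) G)"


section \<open>Probabilistic normed spaces\<close>

text \<open>Linear spaces are modules over the field of real numbers, with explicit carrier, so that
  a subspace and a quotient are spaces of the same kind.\<close>

abbreviation real_ring :: "real ring" where
  "real_ring \<equiv> ring_of_type_algebra"

locale PN_space = Module.module real_ring V
  for V :: "(real, 'v, 'm) module_scheme" (structure) +
  fixes \<nu> :: "'v \<Rightarrow> ereal \<Rightarrow> real"
    and \<tau> \<tau>s :: "(ereal \<Rightarrow> real) \<Rightarrow> (ereal \<Rightarrow> real) \<Rightarrow> (ereal \<Rightarrow> real)"
  assumes tri: "triangle_function \<tau>" "continuous_tf \<tau>"
    and tri_s: "triangle_function \<tau>s" "continuous_tf \<tau>s"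
    and tri_le: "\<And>F G. F \<in> ddf \<Longrightarrow> G \<in> ddf \<Longrightarrow> \<tau> F G \<le> \<tau>s F G"
    and nu_ddf: "\<And>p. p \<in> carrier V \<Longrightarrow> \<nu> p \<in> ddf"
    and N1: "\<And>p. p \<in> carrier V \<Longrightarrow> \<nu> p = eps0 \<longleftrightarrow> p = \<zero>"
    and N2: "\<And>p. p \<in> carrier V \<Longrightarrow> \<nu> (\<ominus> p) = \<nu> p"
    and N3: "\<And>p q. p \<in> carrier V \<Longrightarrow> q \<in> carrier V \<Longrightarrow> \<tau> (\<nu> p) (\<nu> q) \<le> \<nu> (p \<oplus> q)"
    and N4: "\<And>p \<alpha>. p \<in> carrier V \<Longrightarrow> 0 \<le> \<alpha> \<Longrightarrow> \<alpha> \<le> 1 \<Longrightarrow>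
               \<nu> p \<le> \<tau>s (\<nu> (\<alpha> \<odot> p)) (\<nu> ((1 - \<alpha>) \<odot> p))"

definition strong_nhd ::
    "(real, 'v, 'm) module_scheme \<Rightarrow> ('v \<Rightarrow> ereal \<Rightarrow> real) \<Rightarrow> 'v \<Rightarrow> real \<Rightarrow> 'v set" where
  "strong_nhd V \<nu> p t = {q \<in> carrier V. \<nu> (q \<ominus>\<^bsub>V\<^esub> p) (ereal t) > 1 - t}"

definition strong_topology ::
    "(real, 'v, 'm) module_scheme \<Rightarrow> ('v \<Rightarrow> ereal \<Rightarrow> real) \<Rightarrow> 'v topology" where
  "strong_topology V \<nu> =
     topology (\<lambda>U. U \<subseteq> carrier V \<and> (\<forall>p\<in>U. \<exists>t>0. strong_nhd V \<nu> p t \<subseteq> U))"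

definition strongly_convergent_to ::
    "(real, 'v, 'm) module_scheme \<Rightarrow> ('v \<Rightarrow> ereal \<Rightarrow> real) \<Rightarrow> (nat \<Rightarrow> 'v) \<Rightarrow> 'v \<Rightarrow> bool" where
  "strongly_convergent_to V \<nu> s p \<longleftrightarrow>
     (\<forall>t>0. \<exists>N. \<forall>n\<ge>N. s n \<in> strong_nhd V \<nu> p t)"

definition strong_Cauchy ::
    "(real, 'v, 'm) module_scheme \<Rightarrow> ('v \<Rightarrow> ereal \<Rightarrow> real) \<Rightarrow> (nat \<Rightarrow> 'v) \<Rightarrow> bool" where
  "strong_Cauchy V \<nu> s \<longleftrightarrow>
     (\<forall>t>0. \<exists>N. \<forall>m n. m > N \<and> n > N \<longrightarrow> \<nu> (s n \<ominus>\<^bsub>V\<^esub> s m) (ereal t) > 1 - t)"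

definition strongly_complete ::
    "(real, 'v, 'm) module_scheme \<Rightarrow> ('v \<Rightarrow> ereal \<Rightarrow> real) \<Rightarrow> bool" where
  "strongly_complete V \<nu> \<longleftrightarrow>
     (\<forall>s. range s \<subseteq> carrier V \<and> strong_Cauchy V \<nu> s \<longrightarrow>
        (\<exists>p\<in>carrier V. strongly_convergent_to V \<nu> s p))"


section \<open>Quotients\<close>

text \<open>The multiplication and unit fields of a module record play no role in a module.\<close>

definition quot_module ::
    "(real, 'v, 'm) module_scheme \<Rightarrow> 'v set \<Rightarrow> (real, 'v set) module" where
  "quot_module V W =
     \<lparr>carrier = a_rcosets\<^bsub>V\<^esub> W, monoid.mult = undefined, monoid.one = undefined,
      ring.zero = W, ring.add = set_add V,
      module.smult = (\<lambda>\<alpha> K. \<Union>p\<in>K. W +>\<^bsub>V\<^esub> (\<alpha> \<odot>\<^bsub>V\<^esub> p))\<rparr>"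

text \<open>For \<open>K = p + W\<close> the set of all \<open>\<nu> (p + q)\<close> with \<open>q\<close> in \<open>W\<close> is the image of \<open>K\<close>.\<close>

definition quot_norm :: "('v \<Rightarrow> ereal \<Rightarrow> real) \<Rightarrow> 'v set \<Rightarrow> ereal \<Rightarrow> real" where
  "quot_norm \<nu> K = ddf_Sup (\<nu> ` K)"


section \<open>The strong topology, subspaces and quotients are well defined\<close>

text \<open>The declared open sets do form a topology, and submodules and quotients by closed
  submodules are again PN spaces.\<close>

lemma ddf_01: "F \<in> ddf \<Longrightarrow> 0 \<le> F x \<and> F x \<le> 1"
  by (auto simp: ddf_def image_subset_iff)

lemma ddf_bdd: "\<F> \<subseteq> ddf \<Longrightarrow> bdd_above ((\<lambda>F. F x) ` \<F>)"
  by (rule bdd_aboveI[where M=1]) (use ddf_01 in blast)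

lemma ddf_Sup_upper: "\<F> \<subseteq> ddf \<Longrightarrow> F \<in> \<F> \<Longrightarrow> F \<le> ddf_Sup \<F>"
  unfolding ddf_Sup_def le_fun_def by (intro allI cSUP_upper ddf_bdd) auto

lemma ddf_Sup_least: "\<F> \<noteq> {} \<Longrightarrow> (\<And>F. F \<in> \<F> \<Longrightarrow> F \<le> G) \<Longrightarrow> ddf_Sup \<F> \<le> G"
  unfolding ddf_Sup_def le_fun_def by (intro allI cSUP_least) (auto simp: le_fun_def)

lemma ddf_mono: "F \<in> ddf \<Longrightarrow> x \<le> y \<Longrightarrow> F x \<le> F y"
  by (auto simp: ddf_def monoD)

lemma ddf_Sup_in:
  assumes "\<F> \<subseteq> ddf" "\<F> \<noteq> {}" shows "ddf_Sup \<F> \<in> ddf"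
proof -
  let ?S = "ddf_Sup \<F>"
  have le: "F x \<le> ?S x" if "F \<in> \<F>" for F x
    using ddf_Sup_upper[OF assms(1) that] by (simp add: le_fun_def)
  obtain F0 where F0: "F0 \<in> \<F>" using assms by auto
  have rng: "0 \<le> ?S x \<and> ?S x \<le> 1" for x
  proof
    show "0 \<le> ?S x" using le[OF F0, of x] ddf_01[of F0 x] F0 assms by fastforce
    show "?S x \<le> 1" unfolding ddf_Sup_def using assms ddf_01 by (intro cSUP_least) auto
  qed
  have mono: "?S x \<le> ?S y" if "x \<le> y" for x y
    unfolding ddf_Sup_def
  proof (rule cSUP_mono)
    show "bdd_above ((\<lambda>F. F y) ` \<F>)" using assms by (rule_tac ddf_bdd)
    show "\<exists>m\<in>\<F>. n x \<le> m y" if "n \<in> \<F>" for n using that assms ddf_mono \<open>x \<le> y\<close> by blast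
  qed (use assms in auto)
  have cont: "continuous (at_left x) (\<lambda>y. ?S (ereal y))" for x :: real
    unfolding continuous_within
  proof (rule order_tendstoI)
    fix a assume a: "a < ?S (ereal x)"
    then obtain F where F: "F \<in> \<F>" "a < F (ereal x)"
      unfolding ddf_Sup_def by (subst (asm) less_cSUP_iff) (use assms ddf_bdd in auto)
    have "((\<lambda>y. F (ereal y)) \<longlongrightarrow> F (ereal x)) (at_left x)"
      using F assms by (auto simp: ddf_def continuous_within)
    from order_tendstoD(1)[OF this F(2)]
    show "\<forall>\<^sub>F y in at_left x. a < ?S (ereal y)"
      using le[OF F(1)] by (auto elim!: eventually_mono intro: less_le_trans)
  next
    fix a assume a: "?S (ereal x) < a"
    have "\<forall>\<^sub>F y in at_left x. y < x" by (simp add: eventually_at_filter)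
    then show "\<forall>\<^sub>F y in at_left x. ?S (ereal y) < a"
      using a by (auto elim!: eventually_mono intro!: le_less_trans[OF mono a])
  qed
  have c: "?S x = c" if "\<And>F. F \<in> ddf \<Longrightarrow> F x = c" for x c
  proof -
    have "(\<lambda>F. F x) ` \<F> = {c}" using assms that by auto
    then show ?thesis by (simp add: ddf_Sup_def)
  qed
  show ?thesis
    unfolding ddf_def using rng mono cont
    by (auto simp: mono_def intro!: c) (auto simp: ddf_def)
qed

context PN_space begin

lemma strong_nhd_mono:
  assumes "p \<in> carrier V" "0 < s" "s \<le> t"
  shows "strong_nhd V \<nu> p s \<subseteq> strong_nhd V \<nu> p t"
proof
  fix q assume q: "q \<in> strong_nhd V \<nu> p s"
  then have "q \<ominus> p \<in> carrier V" using assms by (auto simp: strong_nhd_def)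
  from ddf_mono[OF nu_ddf[OF this], of "ereal s" "ereal t"] q assms
  show "q \<in> strong_nhd V \<nu> p t" by (auto simp: strong_nhd_def)
qed

lemma openin_strong: "openin (strong_topology V \<nu>) U \<longleftrightarrow>
    U \<subseteq> carrier V \<and> (\<forall>p\<in>U. \<exists>t>0. strong_nhd V \<nu> p t \<subseteq> U)"
proof -
  let ?L = "\<lambda>U. U \<subseteq> carrier V \<and> (\<forall>p\<in>U. \<exists>t>0. strong_nhd V \<nu> p t \<subseteq> U)"
  have "istopology ?L"
    unfolding istopology_def
  proof (intro conjI allI impI)
    fix S T assume S: "?L S" and T: "?L T"
    show "\<forall>p\<in>S \<inter> T. \<exists>t>0. strong_nhd V \<nu> p t \<subseteq> S \<inter> T"
    proof
      fix p assume p: "p \<in> S \<inter> T"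
      then obtain s t where "s>0" "strong_nhd V \<nu> p s \<subseteq> S" "t>0" "strong_nhd V \<nu> p t \<subseteq> T"
        using S T by blast
      moreover have "p \<in> carrier V" using p S by auto
      ultimately show "\<exists>t>0. strong_nhd V \<nu> p t \<subseteq> S \<inter> T"
        using strong_nhd_mono[of p "min s t" s] strong_nhd_mono[of p "min s t" t]
        by (intro exI[of _ "min s t"]) auto
    qed
  next
    fix S T assume S: "?L S" and T: "?L T"
    show "S \<inter> T \<subseteq> carrier V" using S by auto
  next
    fix \<K> assume K: "\<forall>K\<in>\<K>. ?L K"
    show "\<Union>\<K> \<subseteq> carrier V" using K by auto
    show "\<forall>p\<in>\<Union>\<K>. \<exists>t>0. strong_nhd V \<nu> p t \<subseteq> \<Union>\<K>"
    proof
      fix p assume "p \<in> \<Union>\<K>"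
      then obtain T where T: "T \<in> \<K>" "p \<in> T" by blast
      then obtain t where "t>0" "strong_nhd V \<nu> p t \<subseteq> T" using K by meson
      then show "\<exists>t>0. strong_nhd V \<nu> p t \<subseteq> \<Union>\<K>" using T by blast
    qed
  qed
  then show ?thesis by (simp add: strong_topology_def topology_inverse')
qed

lemma topspace_strong: "topspace (strong_topology V \<nu>) = carrier V"
proof -
  have "openin (strong_topology V \<nu>) (carrier V)"
    unfolding openin_strong by (auto simp: strong_nhd_def intro!: exI[of _ 1])
  then show ?thesis
    using openin_strong[of "topspace (strong_topology V \<nu>)"] openin_subset[of "strong_topology V \<nu>"] by auto
qed

lemma closedin_strong: "closedin (strong_topology V \<nu>) S \<longleftrightarrow>
  S \<subseteq> carrier V \<and> (\<forall>p\<in>carrier V - S. \<exists>t>0. strong_nhd V \<nu> p t \<inter> S = {})"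
proof -
  have "strong_nhd V \<nu> p t \<subseteq> carrier V - S \<longleftrightarrow> strong_nhd V \<nu> p t \<inter> S = {}" for p t
    unfolding strong_nhd_def by blast
  then show ?thesis unfolding closedin_def openin_strong topspace_strong by simp
qed

end

lemma real_ring_simps: "carrier real_ring = UNIV" "a \<oplus>\<^bsub>real_ring\<^esub> b = a + b"
  "a \<otimes>\<^bsub>real_ring\<^esub> b = a * b" "\<one>\<^bsub>real_ring\<^esub> = 1"
  by (auto simp: ring_of_type_algebra_def)

context PN_space begin

lemma PN_subspace:
  assumes W: "submodule W real_ring V"
  shows "PN_space (V\<lparr>carrier := W\<rparr>) (restrict \<nu> W) \<tau> \<tau>s"
proof -
  interpret W: submodule W real_ring V by fact
  have sub: "p \<in> W \<Longrightarrow> p \<in> carrier V" for p using W.subset by auto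
  have inv: "a_inv (V\<lparr>carrier := W\<rparr>) p = \<ominus> p" if "p \<in> W" for p
    using M.add.m_inv_consistent[OF W.subgroup_axioms that] by (simp add: a_inv_def)
  have "Module.module real_ring (V\<lparr>carrier := W\<rparr>)"
    by (rule W.submodule_is_module) (rule module_axioms)
  then show ?thesis
    apply (intro PN_space.intro PN_space_axioms.intro)
    apply assumption
    using tri tri_s tri_le nu_ddf N1 N2 N3 N4 sub
    submoduleE[OF W] real_ring_simps by (simp_all add: inv)
qed

end

lemma (in PN_space) quot_in: assumes W: "submodule W real_ring V" and "K \<in> carrier (quot_module V W)"
  shows "\<exists>p\<in>carrier V. K = W +> p"
  using assms by (auto simp: quot_module_def A_RCOSETS_def')

lemma (in PN_space) quot_module_facts:
  assumes W: "submodule W real_ring V"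
  shows "Module.module real_ring (quot_module V W)"
   and "\<And>p q. p \<in> carrier V \<Longrightarrow> q \<in> carrier V \<Longrightarrow> (W +> p) \<oplus>\<^bsub>quot_module V W\<^esub> (W +> q) = W +> (p \<oplus> q)"
   and "\<And>p. p \<in> carrier V \<Longrightarrow> \<ominus>\<^bsub>quot_module V W\<^esub> (W +> p) = W +> (\<ominus> p)"
   and "\<And>a p. p \<in> carrier V \<Longrightarrow> a \<odot>\<^bsub>quot_module V W\<^esub> (W +> p) = W +> (a \<odot> p)"
proof -
  let ?Q = "quot_module V W"
  interpret W: submodule W real_ring V by fact
  interpret S: abelian_subgroup W V
    by (rule abelian_subgroupI3) (auto simp: additive_subgroup_def W.subgroup_axioms M.abelian_group_axioms)
  have car: "carrier ?Q = a_rcosets W" and add: "A \<oplus>\<^bsub>?Q\<^esub> B = A <+> B"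
    and z: "\<zero>\<^bsub>?Q\<^esub> = W" for A B by (simp_all add: quot_module_def)
  have rc: "K \<in> a_rcosets W \<longleftrightarrow> (\<exists>p\<in>carrier V. K = W +> p)" for K by (auto simp: A_RCOSETS_def')
  show A: "\<And>p q. p \<in> carrier V \<Longrightarrow> q \<in> carrier V \<Longrightarrow> (W +> p) \<oplus>\<^bsub>?Q\<^esub> (W +> q) = W +> (p \<oplus> q)"
    by (simp add: add S.a_rcos_sum)
  interpret F: comm_group "V A_Mod W" by (rule S.a_factorgroup_is_comm_group)
  have F: "carrier (V A_Mod W) = carrier ?Q" "mult (V A_Mod W) = add ?Q" "one (V A_Mod W) = \<zero>\<^bsub>?Q\<^esub>"
    by (auto simp: A_FactGroup_def' quot_module_def)
  have cg: "comm_group (add_monoid ?Q)"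
  proof (rule comm_groupI, goal_cases)
    case (1 x y) then show ?case using F.m_closed[of x y] by (simp add: F)
  next
    case 2 then show ?case using F.one_closed by (simp add: F)
  next
    case (3 x y z) then show ?case using F.m_assoc[of x y z] by (simp add: F)
  next
    case (4 x y) then show ?case using F.m_comm[of x y] by (simp add: F)
  next
    case (5 x) then show ?case using F.l_one[of x] by (simp add: F)
  next
    case (6 x) then show ?case using F.l_inv_ex[of x] by (simp add: F)
  qed
  have ag: "abelian_group ?Q"
    unfolding abelian_group_def abelian_group_axioms_def abelian_monoid_def
    using cg comm_group.axioms(1) by blast
  interpret Q: abelian_group ?Q by (rule ag)
  have Wz: "W +> \<zero> = W" by (simp add: S.a_subset)
  show I: "\<And>p. p \<in> carrier V \<Longrightarrow> \<ominus>\<^bsub>?Q\<^esub> (W +> p) = W +> (\<ominus> p)"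
  proof (rule Q.minus_equality)
    fix p assume p: "p \<in> carrier V"
    show "(W +> (\<ominus> p)) \<oplus>\<^bsub>?Q\<^esub> (W +> p) = \<zero>\<^bsub>?Q\<^esub>"
      using p A[of "\<ominus> p" p] by (simp add: M.l_neg Wz z)
    show "W +> p \<in> carrier ?Q" "W +> (\<ominus> p) \<in> carrier ?Q"
      unfolding car rc using p by auto
  qed
  show M: "\<And>a p. p \<in> carrier V \<Longrightarrow> a \<odot>\<^bsub>?Q\<^esub> (W +> p) = W +> (a \<odot> p)"
  proof -
    fix a :: real and p assume p: "p \<in> carrier V"
    have "W +> (a \<odot> x) = W +> (a \<odot> p)" if x: "x \<in> W +> p" for x
    proof -
      obtain w where w: "w \<in> W" "x = w \<oplus> p" using x by (auto simp: a_r_coset_def')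
      have aw: "a \<odot> w \<in> W" using W.smult_closed w by (simp add: real_ring_simps)
      have wc: "w \<in> carrier V" using w S.a_subset by auto
      have "a \<odot> x = a \<odot> w \<oplus> a \<odot> p" using smult_r_distr wc p w by (simp add: real_ring_simps)
      then have "a \<odot> x \<in> W +> (a \<odot> p)" using aw by (auto simp: a_r_coset_def')
      moreover have "a \<odot> p \<in> carrier V" using p by (simp add: real_ring_simps)
      ultimately show ?thesis by (rule S.a_repr_independence'[symmetric])
    qed
    then have "(\<Union>x\<in>W +> p. W +> (a \<odot> x)) = (\<Union>x\<in>W +> p. W +> (a \<odot> p))"
      by (intro SUP_cong refl)
    moreover have "p \<in> W +> p" using p by (rule S.a_rcos_self)
    ultimately show "a \<odot>\<^bsub>?Q\<^esub> (W +> p) = W +> (a \<odot> p)"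
      by (auto simp: quot_module_def)
  qed
  have cl: "\<And>a x. x \<in> carrier V \<Longrightarrow> a \<odot> x \<in> carrier V" by (simp add: real_ring_simps)
  note d = smult_l_distr smult_r_distr smult_assoc1 smult_one
  show "Module.module real_ring ?Q"
  proof (rule moduleI)
    show "cring real_ring" by (rule R.is_cring)
    show "abelian_group ?Q" by (rule ag)
    fix a b :: real and x assume "x \<in> carrier ?Q"
    then obtain p q where p: "p \<in> carrier V" "x = W +> p" unfolding car rc by auto
    show "a \<odot>\<^bsub>?Q\<^esub> x \<in> carrier ?Q" using p M cl car rc by auto
    show "(a \<oplus>\<^bsub>real_ring\<^esub> b) \<odot>\<^bsub>?Q\<^esub> x = a \<odot>\<^bsub>?Q\<^esub> x \<oplus>\<^bsub>?Q\<^esub> b \<odot>\<^bsub>?Q\<^esub> x"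
      using p M A cl d(1)[of a b p] by (simp add: real_ring_simps)
    show "a \<odot>\<^bsub>?Q\<^esub> (x \<oplus>\<^bsub>?Q\<^esub> y) = a \<odot>\<^bsub>?Q\<^esub> x \<oplus>\<^bsub>?Q\<^esub> a \<odot>\<^bsub>?Q\<^esub> y" if y: "y \<in> carrier ?Q" for y
    proof -
      obtain q where q: "q \<in> carrier V" "y = W +> q" using y unfolding car rc by auto
      show ?thesis using p q M A cl d(2)[of a p q] by (simp add: real_ring_simps)
    qed
    show "(a \<otimes>\<^bsub>real_ring\<^esub> b) \<odot>\<^bsub>?Q\<^esub> x = a \<odot>\<^bsub>?Q\<^esub> (b \<odot>\<^bsub>?Q\<^esub> x)"
      using p M cl d(3)[of a b p] by (simp add: real_ring_simps)
    show "\<one>\<^bsub>real_ring\<^esub> \<odot>\<^bsub>?Q\<^esub> x = x"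
      using p M d(4)[of p] by simp
  qed
qed

lemma (in PN_space) quot_norm_coset:
  assumes "submodule W real_ring V" and "p \<in> carrier V"
  shows "quot_norm \<nu> (W +> p) x = (SUP q\<in>W. \<nu> (p \<oplus> q) x)"
proof -
  interpret W: submodule W real_ring V by fact
  have "W +> p = (\<lambda>q. p \<oplus> q) ` W"
    unfolding a_r_coset_def' using W.subset assms(2) M.a_comm by (auto simp: subset_iff image_iff)
  then show ?thesis by (simp add: quot_norm_def ddf_Sup_def image_image)
qed

lemma (in PN_space) quot_PN:
  assumes W: "submodule W real_ring V" and cl: "closedin (strong_topology V \<nu>) W"
    and sc: "sup_continuous_tf \<tau>"
  shows "PN_space (quot_module V W) (quot_norm \<nu>) \<tau> \<tau>s"
proof -
  let ?Q = "quot_module V W"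
  interpret W: submodule W real_ring V by fact
  interpret S: abelian_subgroup W V
    by (rule abelian_subgroupI3) (auto simp: additive_subgroup_def W.subgroup_axioms M.abelian_group_axioms)
  have cos: "W +> p \<subseteq> carrier V" "W +> p \<noteq> {}" "p \<in> W +> p" if "p \<in> carrier V" for p
    using S.a_rcos_self[OF that] that S.a_subset M.a_r_coset_subset_G by auto
  have sub: "\<nu> ` (W +> p) \<subseteq> ddf" "\<nu> ` (W +> p) \<noteq> {}" if "p \<in> carrier V" for p
    using cos[OF that] nu_ddf by auto
  have D: "quot_norm \<nu> (W +> p) \<in> ddf" if "p \<in> carrier V" for p
    unfolding quot_norm_def using sub[OF that] by (rule ddf_Sup_in)
  have U: "\<nu> r \<le> quot_norm \<nu> (W +> p)" if "p \<in> carrier V" "r \<in> W +> p" for p r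
    unfolding quot_norm_def using sub[OF that(1)] that by (intro ddf_Sup_upper) auto
  have z: "\<zero>\<^bsub>?Q\<^esub> = W" by (simp add: quot_module_def)
  have Wz: "W +> \<zero> = W" by (simp add: S.a_subset)
  have e_top: "F \<le> eps0" if "F \<in> ddf" for F
    using ddf_01[OF that] that ddf_mono[OF that, of _ 0]
    by (auto simp: le_fun_def eps0_def ddf_def)
  have e: "\<nu> \<zero> = eps0" using N1 by simp
  show ?thesis
  proof (intro PN_space.intro PN_space_axioms.intro quot_module_facts(1)[OF W] tri tri_s tri_le)
    fix K assume "K \<in> carrier ?Q"
    then obtain p where p: "p \<in> carrier V" "K = W +> p" using quot_in[OF W] by auto
    show "quot_norm \<nu> K \<in> ddf" using D p by simp
    show "quot_norm \<nu> K = eps0 \<longleftrightarrow> K = \<zero>\<^bsub>?Q\<^esub>"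
    proof
      assume "K = \<zero>\<^bsub>?Q\<^esub>"
      then have "\<nu> \<zero> \<le> quot_norm \<nu> K" using U[of \<zero> \<zero>] z Wz by simp
      then show "quot_norm \<nu> K = eps0" using e e_top D p by (metis antisym)
    next
      assume q: "quot_norm \<nu> K = eps0"
      have "p \<in> W"
      proof (rule ccontr)
        assume "p \<notin> W"
        then obtain t where t: "t>0" "strong_nhd V \<nu> p t \<inter> W = {}"
          using cl p unfolding closedin_strong by blast
        have "1 - t < ddf_Sup (\<nu> ` K) (ereal t)" using q t by (auto simp: quot_norm_def eps0_def)
        then obtain F where "F \<in> \<nu> ` K" "1 - t < F (ereal t)"
          unfolding ddf_Sup_def using sub[OF p(1)] p ddf_bdd
          by (subst (asm) less_cSUP_iff) auto
        then obtain w where w: "w \<in> W" "1 - t < \<nu> (w \<oplus> p) (ereal t)"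
          unfolding p by (auto simp: a_r_coset_def')
        have wc: "w \<in> carrier V" using w S.a_subset by auto
        have "\<ominus> (w \<oplus> p) = \<ominus> w \<ominus> p" using wc p by (simp add: M.minus_add M.minus_eq)
        then have "\<ominus> w \<in> strong_nhd V \<nu> p t"
          using w wc p N2[of "w \<oplus> p"] by (simp add: strong_nhd_def)
        moreover have "\<ominus> w \<in> W" using w by simp
        ultimately show False using t by auto
      qed
      then show "K = \<zero>\<^bsub>?Q\<^esub>" unfolding z p by (simp add: M.a_coset_join2 W.subgroup_axioms p)
    qed
    show "quot_norm \<nu> (\<ominus>\<^bsub>?Q\<^esub> K) = quot_norm \<nu> K"
    proof -
      have le: "quot_norm \<nu> (W +> x) \<le> quot_norm \<nu> (W +> (\<ominus> x))" if x: "x \<in> carrier V" for x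
        unfolding quot_norm_def[of _ "W +> x"]
      proof (rule ddf_Sup_least)
        fix F assume "F \<in> \<nu> ` (W +> x)"
        then obtain w where w: "w \<in> W" "F = \<nu> (w \<oplus> x)" by (auto simp: a_r_coset_def')
        have wc: "w \<in> carrier V" using w S.a_subset by auto
        have "F = \<nu> (\<ominus> (w \<oplus> x))" using w N2 wc x by simp
        also have "\<ominus> (w \<oplus> x) = \<ominus> w \<oplus> \<ominus> x" using wc x by (simp add: M.minus_add)
        also have "\<nu> \<dots> \<le> quot_norm \<nu> (W +> (\<ominus> x))"
          by (rule U) (use w x in \<open>auto simp: a_r_coset_def'\<close>)
        finally show "F \<le> quot_norm \<nu> (W +> (\<ominus> x))" .
      qed (use sub[OF x] in auto)
      have "quot_norm \<nu> (W +> p) = quot_norm \<nu> (W +> (\<ominus> p))"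
        using le[of p] le[of "\<ominus> p"] p by (simp add: antisym)
      then show ?thesis using p quot_module_facts(3)[OF W] by simp
    qed
    fix L assume "L \<in> carrier ?Q"
    then obtain q where q: "q \<in> carrier V" "L = W +> q" using quot_in[OF W] by auto
    have T: "ddf_Sup \<F> \<in> ddf" if "\<F> \<subseteq> ddf" "\<F> \<noteq> {}" for \<F> using that by (rule ddf_Sup_in)
    have KL: "\<tau> (\<nu> r) (\<nu> s) \<le> quot_norm \<nu> (W +> (p \<oplus> q))" if "r \<in> K" "s \<in> L" for r s
    proof -
      have rs: "r \<in> carrier V" "s \<in> carrier V" using that cos p q by auto
      have "r \<oplus> s \<in> K <+> L" using that by (auto simp: set_add_def')
      then have "r \<oplus> s \<in> W +> (p \<oplus> q)" using p q S.a_rcos_sum by simp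
      then show ?thesis using U[of "p \<oplus> q" "r \<oplus> s"] N3[OF rs] p q by (auto intro: order_trans)
    qed
    show "\<tau> (quot_norm \<nu> K) (quot_norm \<nu> L) \<le> quot_norm \<nu> (K \<oplus>\<^bsub>?Q\<^esub> L)"
    proof -
      have sc': "ddf_Sup ((\<lambda>F. \<tau> F G) ` \<F>) = \<tau> (ddf_Sup \<F>) G"
        if "\<F> \<subseteq> ddf" "\<F> \<noteq> {}" "G \<in> ddf" for \<F> G
        using sc that unfolding sup_continuous_tf_def by blast
      have com: "\<tau> F G = \<tau> G F" if "F \<in> ddf" "G \<in> ddf" for F G
        using tri that unfolding triangle_function_def by blast
      have 1: "\<tau> (quot_norm \<nu> K) (\<nu> s) \<le> quot_norm \<nu> (W +> (p \<oplus> q))" if s: "s \<in> L" for s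
      proof -
        have "\<nu> s \<in> ddf" using s sub(1)[OF q(1)] q(2) by auto
        from sc'[OF sub[OF p(1)] this]
        have "\<tau> (quot_norm \<nu> K) (\<nu> s) = ddf_Sup ((\<lambda>F. \<tau> F (\<nu> s)) ` \<nu> ` K)"
          by (simp add: quot_norm_def p(2))
        also have "\<dots> \<le> quot_norm \<nu> (W +> (p \<oplus> q))"
          by (rule ddf_Sup_least) (use KL s cos(2)[OF p(1)] p(2) in auto)
        finally show ?thesis .
      qed
      have "\<tau> (quot_norm \<nu> L) (quot_norm \<nu> K) = ddf_Sup ((\<lambda>F. \<tau> F (quot_norm \<nu> K)) ` \<nu> ` L)"
        unfolding quot_norm_def[of _ L] using sc'[OF sub[OF q(1)] D[OF p(1)]] by (simp add: q(2) p(2))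
      also have "\<dots> \<le> quot_norm \<nu> (W +> (p \<oplus> q))"
      proof (rule ddf_Sup_least)
        fix F assume "F \<in> (\<lambda>F. \<tau> F (quot_norm \<nu> K)) ` \<nu> ` L"
        then obtain s where s: "s \<in> L" "F = \<tau> (\<nu> s) (quot_norm \<nu> K)" by auto
        have "\<nu> s \<in> ddf" using s sub(1)[OF q(1)] q(2) by auto
        then show "F \<le> quot_norm \<nu> (W +> (p \<oplus> q))"
          using 1[OF s(1)] s(2) com D[OF p(1)] p(2) by simp
      qed (use cos(2)[OF q(1)] q(2) in simp)
      finally have *: "\<tau> (quot_norm \<nu> L) (quot_norm \<nu> K) \<le> quot_norm \<nu> (W +> (p \<oplus> q))" .
      have "\<tau> (quot_norm \<nu> L) (quot_norm \<nu> K) = \<tau> (quot_norm \<nu> K) (quot_norm \<nu> L)"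
        using com D[OF p(1)] D[OF q(1)] p(2) q(2) by blast
      moreover have "K \<oplus>\<^bsub>?Q\<^esub> L = W +> (p \<oplus> q)" using p q quot_module_facts(2)[OF W] by simp
      ultimately show ?thesis using * by simp
    qed
  next
    fix K and \<alpha> :: real assume "K \<in> carrier ?Q" and a: "0 \<le> \<alpha>" "\<alpha> \<le> 1"
    then obtain p where p: "p \<in> carrier V" "K = W +> p" using quot_in[OF W] by auto
    have c: "\<And>a x. x \<in> carrier V \<Longrightarrow> a \<odot> x \<in> carrier V" by (simp add: real_ring_simps)
    have mono: "\<tau>s F G \<le> \<tau>s F' G'" if "F \<le> F'" "G \<le> G'" "F \<in> ddf" "G \<in> ddf" "F' \<in> ddf" "G' \<in> ddf" for F G F' G'

    proof -
      have "\<tau>s F G \<le> \<tau>s F' G" using tri_s(1) that unfolding triangle_function_def by blast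
      also have "\<tau>s F' G \<le> \<tau>s F' G'" using tri_s(1) that unfolding triangle_function_def by blast
      finally show ?thesis .
    qed
    have "quot_norm \<nu> (W +> p) \<le> \<tau>s (quot_norm \<nu> (W +> (\<alpha> \<odot> p))) (quot_norm \<nu> (W +> ((1 - \<alpha>) \<odot> p)))"
      unfolding quot_norm_def[of _ "W +> p"]
    proof (rule ddf_Sup_least)
      fix F assume "F \<in> \<nu> ` (W +> p)"
      then obtain w where w: "w \<in> W" "F = \<nu> (w \<oplus> p)" by (auto simp: a_r_coset_def')
      have wc: "w \<in> carrier V" using w S.a_subset by auto
      have in': "b \<odot> (w \<oplus> p) \<in> W +> (b \<odot> p)" for b
      proof -
        have "b \<odot> (w \<oplus> p) = b \<odot> w \<oplus> b \<odot> p" using smult_r_distr wc p by (simp add: real_ring_simps)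
        moreover have "b \<odot> w \<in> W" using W.smult_closed w by (simp add: real_ring_simps)
        ultimately show ?thesis by (auto simp: a_r_coset_def')
      qed
      have "F \<le> \<tau>s (\<nu> (\<alpha> \<odot> (w \<oplus> p))) (\<nu> ((1-\<alpha>) \<odot> (w \<oplus> p)))" using w N4 wc p a by simp
      also have "\<dots> \<le> \<tau>s (quot_norm \<nu> (W +> (\<alpha> \<odot> p))) (quot_norm \<nu> (W +> ((1 - \<alpha>) \<odot> p)))"
        by (intro mono U in' D nu_ddf c M.add.m_closed wc p)
      finally show "F \<le> \<tau>s (quot_norm \<nu> (W +> (\<alpha> \<odot> p))) (quot_norm \<nu> (W +> ((1 - \<alpha>) \<odot> p)))" .
    qed (use sub[OF p(1)] in auto)
    then show "quot_norm \<nu> K \<le> \<tau>s (quot_norm \<nu> (\<alpha> \<odot>\<^bsub>?Q\<^esub> K)) (quot_norm \<nu> ((1 - \<alpha>) \<odot>\<^bsub>?Q\<^esub> K))"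
      using p quot_module_facts(4)[OF W] by simp
  qed
qed

end

theory Submission
  imports Defs
begin

text \<open>By continuity of \<open>\<tau>\<close> at \<open>(\<epsilon>\<^sub>0, \<epsilon>\<^sub>0)\<close>, the relations \<open>\<nu> (p - q) t > 1 - t\<close> form a countably
  based translation-invariant uniformity, and two cosets are \<open>t\<close>-close in the quotient iff any
  representative of one is \<open>t\<close>-close to some representative of the other. The classical argument
  for topological groups then applies. If \<open>V\<close> is complete, a rapidly Cauchy subsequence of cosets
  lifts to a Cauchy sequence in \<open>V\<close>. If \<open>W\<close> and the quotient are complete and \<open>s\<close> is Cauchy in \<open>V\<close>
  with cosets tending to \<open>p + W\<close>, then a subsequence of \<open>s\<close> is approximated by elements of \<open>p + W\<close>,
  whose translates by \<open>-p\<close> converge in \<open>W\<close>. A closed subspace of a complete space is complete.\<close>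

section \<open>Sibley distance from \<open>eps0\<close>\<close>

text \<open>Both conditions hold at \<open>h = s\<close>: \<open>F\<close> vanishes on x \<le> 0 and
  exceeds \<open>1 - s\<close> from \<open>s\<close> onwards, which settles every case where the
  bound is not trivial. Settling for a weak inequality avoids left-continuity.\<close>

lemma sibley_dist_eps0_le:
  assumes F: "F \<in> ddf" and s: "0 < s" "s \<le> 1" "F (ereal s) > 1 - s"
  shows "sibley_dist eps0 F \<le> s"
proof -
  have zero: "F (ereal x) = 0" if "x \<le> 0" for x
    using ddf_mono[OF F, of "ereal x" 0] ddf_01[OF F, of "ereal x"] that F
    by (auto simp: ddf_def zero_ereal_def)
  have big: "1 - s < F (ereal x)" if "s \<le> x" for x
    using ddf_mono[OF F, of "ereal s" "ereal x"] that s by simp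
  have "sibley_cond eps0 F s" "sibley_cond F eps0 s"
    unfolding sibley_cond_def eps0_def
    using zero big s ddf_01[OF F] by (auto simp: less_imp_le algebra_simps add_increasing)
  then show ?thesis
    unfolding sibley_dist_def using s by (intro cInf_lower) (auto intro: bdd_belowI[where m=0])
qed

text \<open>Some admissible \<open>h\<close> lies below \<open>t\<close>. Just to the right of
  \<open>h\<close> the shifted \<open>eps0\<close> is already 1, so \<open>F\<close> is at least
  \<open>1 - h\<close> there.\<close>

lemma sibley_dist_eps0_less_imp:
  assumes F: "F \<in> ddf" and t: "t \<le> 1" "sibley_dist eps0 F < t"
  shows "F (ereal t) > 1 - t"
proof -
  let ?S = "{h. 0 < h \<and> h \<le> 1 \<and> sibley_cond eps0 F h \<and> sibley_cond F eps0 h}"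
  \<comment> \<open>The infimum of a set of reals is informative only if the set is
    nonempty.\<close>
  have "1 \<in> ?S"
    using ddf_01[OF F] by (auto simp: sibley_cond_def eps0_def intro: order_trans[of _ 0] order_trans[of _ 1])
  then obtain h where h: "h \<in> ?S" "h < t"
    using t(2) cInf_lessD[of ?S t] unfolding sibley_dist_def by blast
  then have "h < 1 / h"
    using t by (auto simp: field_simps) (smt (verit) mult_less_cancel_left2)
  \<comment> \<open>The point lies beyond \<open>h\<close>, so that \<open>eps0 (x - h)\<close> is
    1, below \<open>1 / h\<close>, so that the Sibley condition covers it, and below
    \<open>t\<close>, so that monotonicity carries the bound to \<open>t\<close>.\<close>
  then obtain x where x: "h < x" "x < min t (1 / h)"
    using h(2) dense[of h "min t (1 / h)"] by auto
  then have "- 1 / h < x" using h by (auto intro: less_trans[of _ 0])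
  then have "x \<in> {- 1 / h<..<1 / h}" using x by simp
  then have "eps0 (ereal (x - h)) - h \<le> F (ereal x)"
    using h(1) unfolding sibley_cond_def by blast
  then have "1 - h \<le> F (ereal x)"
    using x by (simp add: eps0_def)
  also have "\<dots> \<le> F (ereal t)" using x by (intro ddf_mono[OF F]) auto
  finally show ?thesis using h by linarith
qed

section \<open>The strong uniformity\<close>

text \<open>The entourage of size \<open>t\<close>. Module and norm are parameters, so that nearness
  in the space, the subspace and the quotient can be compared.\<close>

definition strong_near ::
    "(real, 'v, 'm) module_scheme \<Rightarrow> ('v \<Rightarrow> ereal \<Rightarrow> real) \<Rightarrow> real \<Rightarrow> 'v \<Rightarrow> 'v \<Rightarrow> bool" where
  "strong_near V \<nu> t p q \<longleftrightarrow> \<nu> (p \<ominus>\<^bsub>V\<^esub> q) (ereal t) > 1 - t"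

lemma strong_Cauchy_iff_near:
  "strong_Cauchy V \<nu> s \<longleftrightarrow> (\<forall>t>0. \<exists>N. \<forall>m>N. \<forall>n>N. strong_near V \<nu> t (s n) (s m))"
  unfolding strong_Cauchy_def strong_near_def by blast

lemma strongly_convergent_to_iff_near:
  assumes "range s \<subseteq> carrier V"
  shows "strongly_convergent_to V \<nu> s p \<longleftrightarrow> (\<forall>t>0. \<exists>N. \<forall>n\<ge>N. strong_near V \<nu> t (s n) p)"
proof -
  have "s n \<in> carrier V" for n using assms by auto
  then show ?thesis by (simp add: strongly_convergent_to_def strong_nhd_def strong_near_def)
qed

context PN_space begin

lemma near_refl: "p \<in> carrier V \<Longrightarrow> 0 < t \<Longrightarrow> strong_near V \<nu> t p p"
  using N1[of \<zero>] by (simp add: strong_near_def M.minus_eq M.r_neg eps0_def)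

lemma near_mono:
  assumes "p \<in> carrier V" "q \<in> carrier V" "s \<le> t" "strong_near V \<nu> s p q"
  shows "strong_near V \<nu> t p q"
  using ddf_mono[OF nu_ddf, of "p \<ominus> q" "ereal s" "ereal t"] assms by (simp add: strong_near_def)

lemma near_sym:
  assumes "p \<in> carrier V" "q \<in> carrier V" "strong_near V \<nu> t p q"
  shows "strong_near V \<nu> t q p"
proof -
  have "\<ominus> (p \<ominus> q) = q \<ominus> p" using assms by (simp add: M.minus_eq M.minus_add M.a_comm)
  then show ?thesis using assms N2[of "p \<ominus> q"] by (simp add: strong_near_def)
qed

lemma diff_add_diff:
  assumes "p \<in> carrier V" "q \<in> carrier V" "r \<in> carrier V"
  shows "(p \<ominus> q) \<oplus> (q \<ominus> r) = p \<ominus> r"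
  using assms by (simp add: M.minus_eq M.a_assoc M.r_neg2 M.r_neg1)

text \<open>This replaces the triangle inequality: N3 bounds the norm of \<open>p - r\<close> below
  by \<open>\<tau>\<close> of the norms of \<open>p - q\<close> and \<open>q - r\<close>, and
  continuity keeps that value close to \<open>\<tau> eps0 eps0 = eps0\<close>.\<close>

lemma near_trans:
  assumes "0 < t"
  obtains s where "0 < s" "s \<le> t"
    "\<And>p q r. p \<in> carrier V \<Longrightarrow> q \<in> carrier V \<Longrightarrow> r \<in> carrier V \<Longrightarrow>
       strong_near V \<nu> s p q \<Longrightarrow> strong_near V \<nu> s q r \<Longrightarrow> strong_near V \<nu> t p r"
proof -
  \<comment> \<open>Passing from Sibley distance back to nearness requires a size of at most
    1.\<close>
  define u where "u = min t 1"
  have e: "eps0 \<in> ddf" using N1[of \<zero>] nu_ddf[of \<zero>] by simp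
  then have tee: "\<tau> eps0 eps0 = eps0" using tri(1) unfolding triangle_function_def by blast
  have u: "0 < u" "u \<le> 1" "u \<le> t" using assms by (auto simp: u_def)
  obtain d where d: "d > 0" "\<And>F G. F \<in> ddf \<Longrightarrow> G \<in> ddf \<Longrightarrow> sibley_dist eps0 F < d \<Longrightarrow>
      sibley_dist eps0 G < d \<Longrightarrow> sibley_dist eps0 (\<tau> F G) < u"
    using tri(2) e u(1) tee unfolding continuous_tf_def by metis
  \<comment> \<open>Nearness of size \<open>s\<close> only gives Sibley distance at most
    \<open>s\<close>; halving \<open>d\<close> makes this strictly less than
    \<open>d\<close>.\<close>
  define s where "s = min (d / 2) u"
  have s: "0 < s" "s \<le> 1" "s < d" "s \<le> t" using d u by (auto simp: s_def)
  have "strong_near V \<nu> t p r"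
    if pqr: "p \<in> carrier V" "q \<in> carrier V" "r \<in> carrier V"
      and near: "strong_near V \<nu> s p q" "strong_near V \<nu> s q r" for p q r
  proof -
    have c: "p \<ominus> q \<in> carrier V" "q \<ominus> r \<in> carrier V" using pqr by auto
    have "\<tau> (\<nu> (p \<ominus> q)) (\<nu> (q \<ominus> r)) \<in> ddf"
      using tri(1) nu_ddf[OF c(1)] nu_ddf[OF c(2)] unfolding triangle_function_def by blast
    moreover have "sibley_dist eps0 (\<tau> (\<nu> (p \<ominus> q)) (\<nu> (q \<ominus> r))) < u"
      using near s c nu_ddf
      by (intro d(2) le_less_trans[OF sibley_dist_eps0_le]) (auto simp: strong_near_def)
    ultimately have "\<tau> (\<nu> (p \<ominus> q)) (\<nu> (q \<ominus> r)) (ereal u) > 1 - u"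
      using u(2) by (intro sibley_dist_eps0_less_imp)
    then have "strong_near V \<nu> u p r"
      using N3[OF c] unfolding diff_add_diff[OF pqr] strong_near_def le_fun_def
      by (meson less_le_trans)
    then show ?thesis using near_mono pqr u by blast
  qed
  then show thesis using that s by blast
qed

text \<open>The selection \<open>f\<close> need not be increasing: \<open>k \<le> f k\<close>
  already takes its indices past every bound, and the Cauchy property compares the remaining terms
  with such a selected term.\<close>

lemma strong_Cauchy_subseq_convergent:
  assumes s: "range s \<subseteq> carrier V" "strong_Cauchy V \<nu> s" and p: "p \<in> carrier V"
    and f: "\<And>k. k \<le> f k" and conv: "strongly_convergent_to V \<nu> (s \<circ> f) p"
  shows "strongly_convergent_to V \<nu> s p"
proof -
  have sc: "s n \<in> carrier V" for n using s(1) by auto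
  have conv': "\<forall>t>0. \<exists>N. \<forall>n\<ge>N. strong_near V \<nu> t (s (f n)) p"
    using conv sc by (subst (asm) strongly_convergent_to_iff_near) auto
  show ?thesis
    unfolding strongly_convergent_to_iff_near[OF s(1)]
  proof (intro allI impI)
    fix t :: real assume "0 < t"
    then obtain u where u: "0 < u" and tr: "\<And>p q r. p \<in> carrier V \<Longrightarrow> q \<in> carrier V \<Longrightarrow>
        r \<in> carrier V \<Longrightarrow> strong_near V \<nu> u p q \<Longrightarrow> strong_near V \<nu> u q r \<Longrightarrow>
        strong_near V \<nu> t p r" by (rule near_trans) blast
    obtain N where N: "\<And>m n. m > N \<Longrightarrow> n > N \<Longrightarrow> strong_near V \<nu> u (s n) (s m)"
      using s(2) u unfolding strong_Cauchy_iff_near by blast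
    obtain M where M: "\<And>n. n \<ge> M \<Longrightarrow> strong_near V \<nu> u (s (f n)) p"
      using conv' u by blast
    have "f (max M (Suc N)) > N" using f[of "max M (Suc N)"] by linarith
    then have "strong_near V \<nu> t (s n) p" if "n \<ge> Suc N" for n
      using tr[OF sc sc p N M, of "max M (Suc N)" n] that by auto
    then show "\<exists>N. \<forall>n\<ge>N. strong_near V \<nu> t (s n) p" by blast
  qed
qed

section \<open>Nearness in subspaces and quotients\<close>

lemma strong_near_subspace:
  assumes W: "submodule W real_ring V" and p: "p \<in> W" and q: "q \<in> W"
  shows "strong_near (V\<lparr>carrier := W\<rparr>) (restrict \<nu> W) t p q \<longleftrightarrow> strong_near V \<nu> t p q"
proof -
  interpret W: submodule W real_ring V by fact
  have "p \<ominus>\<^bsub>V\<lparr>carrier := W\<rparr>\<^esub> q = p \<ominus> q"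
    using M.add.m_inv_consistent[OF W.subgroup_axioms q] by (simp add: a_minus_def a_inv_def)
  \<comment> \<open>Off \<open>W\<close> the restricted norm is \<open>undefined\<close>, so the
    difference has to stay in \<open>W\<close>.\<close>
  moreover have "p \<ominus> q \<in> W"
    using p submoduleE(3,5)[OF W] q by (simp add: M.minus_eq)
  ultimately show ?thesis by (simp add: strong_near_def)
qed

lemma submodule_coset:
  assumes W: "submodule W real_ring V" and p: "p \<in> carrier V"
  shows "W +> p \<subseteq> carrier V" "p \<in> W +> p" "W +> p \<in> carrier (quot_module V W)"
    "r \<in> W +> p \<Longrightarrow> W +> r = W +> p"
proof -
  interpret W: submodule W real_ring V by fact
  interpret S: abelian_subgroup W V
    by (rule abelian_subgroupI3)
      (auto simp: additive_subgroup_def W.subgroup_axioms M.abelian_group_axioms)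
  show "W +> p \<subseteq> carrier V" using p S.a_subset M.a_r_coset_subset_G by blast
  show "p \<in> W +> p" using p by (rule S.a_rcos_self)
  show "W +> p \<in> carrier (quot_module V W)" using p by (auto simp: quot_module_def A_RCOSETS_def')
  show "r \<in> W +> p \<Longrightarrow> W +> r = W +> p" using S.a_repr_independence' p by metis
qed

text \<open>A supremum strictly exceeds \<open>1 - t\<close> iff some member does, so no size is
  lost even when the supremum is not attained. The coset of \<open>p - q\<close> is the coset of
  \<open>p\<close> shifted by \<open>q\<close>, which lets \<open>q\<close> stay fixed.\<close>

lemma strong_near_quot:
  assumes W: "submodule W real_ring V" and p: "p \<in> carrier V" and q: "q \<in> carrier V"
  shows "strong_near (quot_module V W) (quot_norm \<nu>) t (W +> p) (W +> q) \<longleftrightarrow>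
    (\<exists>r\<in>W +> p. strong_near V \<nu> t r q)"
proof -
  interpret W: submodule W real_ring V by fact
  have sub: "W \<subseteq> carrier V" using W.subset by simp
  have "(W +> p) \<ominus>\<^bsub>quot_module V W\<^esub> (W +> q) = W +> (p \<ominus> q)"
    using p q quot_module_facts(2,3)[OF W] by (simp add: a_minus_def)
  moreover have "\<nu> ` (W +> (p \<ominus> q)) \<subseteq> ddf" "\<nu> ` (W +> (p \<ominus> q)) \<noteq> {}"
    using submodule_coset(1,2)[OF W, of "p \<ominus> q"] p q nu_ddf by auto
  moreover have "W +> (p \<ominus> q) = (\<lambda>r. r \<ominus> q) ` (W +> p)"
  proof -
    have "w \<oplus> (p \<ominus> q) = (w \<oplus> p) \<ominus> q" if "w \<in> W" for w
      using subsetD[OF sub that] p q by (simp add: M.minus_eq M.a_assoc)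
    then show ?thesis by (simp add: a_r_coset_def' image_UN)
  qed
  ultimately show ?thesis
    unfolding strong_near_def quot_norm_def ddf_Sup_def
    using less_cSUP_iff[OF _ ddf_bdd, of "\<nu> ` (W +> (p \<ominus> q))" "1 - t" "ereal t"]
    by simp
qed

section \<open>Completeness of closed subspaces\<close>

text \<open>The limit found in \<open>V\<close> lies in \<open>W\<close>: otherwise it would have a
  strong neighbourhood missing \<open>W\<close>, yet that neighbourhood contains terms of the
  sequence.\<close>

lemma strongly_complete_subspace:
  assumes W: "submodule W real_ring V" and cl: "closedin (strong_topology V \<nu>) W"
    and V: "strongly_complete V \<nu>"
  shows "strongly_complete (V\<lparr>carrier := W\<rparr>) (restrict \<nu> W)"
  unfolding strongly_complete_def
proof (intro allI impI, elim conjE)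
  let ?W = "V\<lparr>carrier := W\<rparr>"
  fix s assume r: "range s \<subseteq> carrier ?W" and C: "strong_Cauchy ?W (restrict \<nu> W) s"
  have sW: "s n \<in> W" for n using r by auto
  have WV: "W \<subseteq> carrier V" using cl by (simp add: closedin_strong)
  then have sV: "range s \<subseteq> carrier V" using sW by auto
  have "strong_Cauchy V \<nu> s"
    using C strong_near_subspace[OF W sW sW] by (simp add: strong_Cauchy_iff_near)
  then obtain p where p: "p \<in> carrier V" "strongly_convergent_to V \<nu> s p"
    using V sV unfolding strongly_complete_def by blast
  have pW: "p \<in> W"
  proof (rule ccontr)
    assume "p \<notin> W"
    then obtain t where "t > 0" "strong_nhd V \<nu> p t \<inter> W = {}"
      using cl p(1) unfolding closedin_strong by blast
    then show False using p(2) sW unfolding strongly_convergent_to_def by blast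
  qed
  have "strongly_convergent_to ?W (restrict \<nu> W) s p"
    using p(2) strong_near_subspace[OF W sW pW]
    by (simp add: strongly_convergent_to_iff_near[OF r] strongly_convergent_to_iff_near[OF sV])
  then show "\<exists>p\<in>carrier ?W. strongly_convergent_to ?W (restrict \<nu> W) s p" using pW by auto
qed

section \<open>Completeness of the quotient\<close>

text \<open>Each scale allows composing two steps into the previous one, so the steps of sizes
  \<open>t (Suc k)\<close>, \<open>t (Suc (Suc k))\<close>, \<dots> add up to size \<open>t k\<close>.\<close>

lemma near_scales:
  obtains t :: "nat \<Rightarrow> real" where "\<And>k. 0 < t k" "\<And>u. 0 < u \<Longrightarrow> \<exists>k. t k \<le> u"
    "\<And>k p q r. p \<in> carrier V \<Longrightarrow> q \<in> carrier V \<Longrightarrow> r \<in> carrier V \<Longrightarrow>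
       strong_near V \<nu> (t (Suc k)) p q \<Longrightarrow> strong_near V \<nu> (t (Suc k)) q r \<Longrightarrow>
       strong_near V \<nu> (t k) p r"
proof -
  have "\<exists>t. \<forall>k. (0 < t k \<and> t k \<le> (1/2) ^ k) \<and>
    (\<forall>p\<in>carrier V. \<forall>q\<in>carrier V. \<forall>r\<in>carrier V. strong_near V \<nu> (t (Suc k)) p q \<longrightarrow>
       strong_near V \<nu> (t (Suc k)) q r \<longrightarrow> strong_near V \<nu> (t k) p r)"
  proof (rule dependent_nat_choice)
    show "\<exists>x::real. 0 < x \<and> x \<le> (1/2) ^ 0" by (intro exI[of _ 1]) simp
    fix x :: real and k assume x: "0 < x \<and> x \<le> (1/2) ^ k"
    then obtain u where u: "0 < u" "u \<le> x" "\<And>p q r. p \<in> carrier V \<Longrightarrow> q \<in> carrier V \<Longrightarrow>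
        r \<in> carrier V \<Longrightarrow> strong_near V \<nu> u p q \<Longrightarrow> strong_near V \<nu> u q r \<Longrightarrow>
        strong_near V \<nu> x p r" using near_trans[of x] by metis
    \<comment> \<open>The bound \<open>u\<close> provides the composition property, and the power of
      1/2 forces the scales to tend to 0.\<close>
    let ?y = "min u ((1/2) ^ Suc k)"
    have "strong_near V \<nu> x p r" if "p \<in> carrier V" "q \<in> carrier V" "r \<in> carrier V"
      "strong_near V \<nu> ?y p q" "strong_near V \<nu> ?y q r" for p q r
      using that by (intro u(3)[of p q r] near_mono[of _ _ ?y u]) auto
    then show "\<exists>y. (0 < y \<and> y \<le> (1/2) ^ Suc k) \<and>
      (\<forall>p\<in>carrier V. \<forall>q\<in>carrier V. \<forall>r\<in>carrier V. strong_near V \<nu> y p q \<longrightarrow>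
       strong_near V \<nu> y q r \<longrightarrow> strong_near V \<nu> x p r)"
      using u(1) by (intro exI[of _ ?y]) auto
  qed
  then obtain t where t: "\<And>k. 0 < t k" "\<And>k. t k \<le> (1/2) ^ k"
    "\<And>k p q r. p \<in> carrier V \<Longrightarrow> q \<in> carrier V \<Longrightarrow> r \<in> carrier V \<Longrightarrow>
       strong_near V \<nu> (t (Suc k)) p q \<Longrightarrow> strong_near V \<nu> (t (Suc k)) q r \<Longrightarrow>
       strong_near V \<nu> (t k) p r" by blast
  have "\<exists>k. t k \<le> u" if "0 < u" for u
    using real_arch_pow_inv[OF that, of "1/2"] t(2) by (auto intro: order_trans less_imp_le)
  then show thesis by (rule that[OF t(1) _ t(3)])
qed

text \<open>Along a fast subsequence, each new coset contains a representative close to the one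
  chosen before. The representatives converge to some \<open>p\<close>, so the subsequence converges
  to \<open>W +> p\<close>, and with it the whole Cauchy sequence.\<close>

lemma strongly_complete_quot:
  assumes W: "submodule W real_ring V" and Q: "PN_space (quot_module V W) (quot_norm \<nu>) \<tau> \<tau>s"
    and V: "strongly_complete V \<nu>"
  shows "strongly_complete (quot_module V W) (quot_norm \<nu>)"
  unfolding strongly_complete_def
proof (intro allI impI, elim conjE)
  let ?Q = "quot_module V W"
  interpret Q: PN_space ?Q "quot_norm \<nu>" \<tau> \<tau>s by (rule Q)
  fix S assume r: "range S \<subseteq> carrier ?Q" and C: "strong_Cauchy ?Q (quot_norm \<nu>) S"
  have rep: "p \<in> carrier V \<and> W +> p = S n" if "p \<in> S n" for p n
  proof -
    obtain q where "q \<in> carrier V" "S n = W +> q" using quot_in[OF W] r by blast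
    then show ?thesis
      using submodule_coset(1)[OF W, of q] submodule_coset(4)[OF W, of q p] that by auto
  qed
  have ne: "\<exists>p. p \<in> S n" for n
    using quot_in[OF W, of "S n"] r submodule_coset(2)[OF W] by blast
  obtain t where t: "\<And>k. 0 < t k" "\<And>u. 0 < u \<Longrightarrow> \<exists>k. t k \<le> u"
    and tr: "\<And>k p q r. p \<in> carrier V \<Longrightarrow> q \<in> carrier V \<Longrightarrow> r \<in> carrier V \<Longrightarrow>
       strong_near V \<nu> (t (Suc k)) p q \<Longrightarrow> strong_near V \<nu> (t (Suc k)) q r \<Longrightarrow>
       strong_near V \<nu> (t k) p r" using near_scales by blast
  have "\<forall>k. \<exists>N. \<forall>m>N. \<forall>n>N. strong_near ?Q (quot_norm \<nu>) (t k) (S n) (S m)"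
    using C t(1) unfolding strong_Cauchy_iff_near by blast
  then obtain N where N: "\<And>k m n. m > N k \<Longrightarrow> n > N k \<Longrightarrow>
      strong_near ?Q (quot_norm \<nu>) (t k) (S n) (S m)" by metis
  \<comment> \<open>Each \<open>g k\<close> pairs an index with a representative of the coset at
    that index. The index exceeds \<open>N (Suc k)\<close>, so any later coset is within
    \<open>t (Suc k)\<close> of this one.\<close>
  have "\<exists>g. \<forall>k. (k \<le> fst (g k) \<and> N (Suc k) < fst (g k) \<and> snd (g k) \<in> S (fst (g k))) \<and>
      strong_near V \<nu> (t (Suc k)) (snd (g (Suc k))) (snd (g k))"
  proof (rule dependent_nat_choice)
    show "\<exists>x. 0 \<le> fst x \<and> N (Suc 0) < fst x \<and> snd x \<in> S (fst x)"
      using ne by (metis fst_conv lessI snd_conv zero_le)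
    fix x :: "nat \<times> 'v" and k assume x: "k \<le> fst x \<and> N (Suc k) < fst x \<and> snd x \<in> S (fst x)"
    \<comment> \<open>Exceeding \<open>fst x\<close> also puts \<open>n\<close> above
      \<open>N (Suc k)\<close>, as the step from \<open>x\<close> requires; the last bound serves
      the next step.\<close>
    define n where "n = Suc (max (max k (fst x)) (N (Suc (Suc k))))"
    obtain q where q: "q \<in> S n" using ne by blast
    have "strong_near ?Q (quot_norm \<nu>) (t (Suc k)) (S n) (S (fst x))"
      using x by (intro N) (auto simp: n_def)
    \<comment> \<open>Here \<open>q\<close> only presents \<open>S n\<close> as a coset; the
      representative kept is \<open>p\<close>, near \<open>snd x\<close>.\<close>
    then obtain p where "p \<in> S n" "strong_near V \<nu> (t (Suc k)) p (snd x)"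
      using strong_near_quot[OF W, of q "snd x"] rep[OF q] rep[of "snd x" "fst x"] x by auto
    then show "\<exists>y. (Suc k \<le> fst y \<and> N (Suc (Suc k)) < fst y \<and> snd y \<in> S (fst y)) \<and>
        strong_near V \<nu> (t (Suc k)) (snd y) (snd x)"
      by (intro exI[of _ "(n, p)"]) (auto simp: n_def)
  qed
  then obtain g where g: "\<And>k. k \<le> fst (g k)" "\<And>k. snd (g k) \<in> S (fst (g k))"
    "\<And>k. strong_near V \<nu> (t (Suc k)) (snd (g (Suc k))) (snd (g k))" by blast
  define s where "s k = snd (g k)" for k
  have s: "s k \<in> carrier V" "W +> s k = S (fst (g k))" for k
    using rep[OF g(2)[of k]] by (auto simp: s_def)
  \<comment> \<open>The induction hypothesis is used at \<open>Suc k\<close>: the steps from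
    \<open>Suc k\<close> on total \<open>t (Suc k)\<close>, and the first step, of the same size,
    completes \<open>t k\<close>.\<close>
  have tail: "strong_near V \<nu> (t k) (s (k + m)) (s k)" for m k
  proof (induction m arbitrary: k)
    case 0 then show ?case using near_refl s t by simp
  next
    case (Suc m)
    show ?case using tr[OF s(1) s(1) s(1) Suc[of "Suc k"]] g(3)[of k] by (simp add: s_def)
  qed
  have "strong_Cauchy V \<nu> s"
    unfolding strong_Cauchy_iff_near
  proof (intro allI impI)
    fix u :: real assume "0 < u"
    then obtain k where k: "t k \<le> u" using t by blast
    have c: "strong_near V \<nu> (t (Suc k)) (s n) (s (Suc k))" if "n > k" for n
      using tail[of "Suc k" "n - Suc k"] that by simp
    have "strong_near V \<nu> u (s n) (s m)" if "m > k" "n > k" for m n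
      using tr[OF s(1) s(1) s(1) c[OF that(2)] near_sym[OF s(1) s(1) c[OF that(1)]]]
        near_mono[OF s(1) s(1) k] by blast
    then show "\<exists>N. \<forall>m>N. \<forall>n>N. strong_near V \<nu> u (s n) (s m)" by blast
  qed
  then obtain p where p: "p \<in> carrier V" "strongly_convergent_to V \<nu> s p"
    using V s(1) unfolding strongly_complete_def by blast
  \<comment> \<open>Projection to the quotient preserves nearness, the representative
    \<open>s k\<close> itself being the witness.\<close>
  have near: "strong_near ?Q (quot_norm \<nu>) u (S (fst (g k))) (W +> p)"
    if "strong_near V \<nu> u (s k) p" for u k
    using strong_near_quot[OF W s(1)[of k] p(1)] that submodule_coset(2)[OF W s(1)[of k]]
    by (auto simp: s(2))
  have rs: "range s \<subseteq> carrier V" and rS: "range (S \<circ> (\<lambda>k. fst (g k))) \<subseteq> carrier ?Q"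
    using s(1) r by auto
  have "strongly_convergent_to ?Q (quot_norm \<nu>) (S \<circ> (\<lambda>k. fst (g k))) (W +> p)"
    unfolding strongly_convergent_to_iff_near[OF rS]
  proof (intro allI impI)
    fix u :: real assume "0 < u"
    then obtain M where "\<And>k. M \<le> k \<Longrightarrow> strong_near V \<nu> u (s k) p"
      using p(2) unfolding strongly_convergent_to_iff_near[OF rs] by blast
    then show "\<exists>M. \<forall>k\<ge>M. strong_near ?Q (quot_norm \<nu>) u ((S \<circ> (\<lambda>k. fst (g k))) k) (W +> p)"
      using near by (intro exI[of _ M]) simp
  qed
  \<comment> \<open>The subsequence argument is now applied in the quotient, which is why that has
    to be a PN space.\<close>
  then have "strongly_convergent_to ?Q (quot_norm \<nu>) S (W +> p)"
    by (rule Q.strong_Cauchy_subseq_convergent[OF r C submodule_coset(3)[OF W p(1)] g(1)])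
  then show "\<exists>K\<in>carrier ?Q. strongly_convergent_to ?Q (quot_norm \<nu>) S K"
    using submodule_coset(3)[OF W p(1)] by blast
qed

section \<open>Completeness of the whole space from subspace and quotient\<close>

lemma near_perturb:
  assumes "\<And>k. a k \<in> carrier V" "\<And>k. b k \<in> carrier V"
    and ab: "\<And>k. strong_near V \<nu> (inverse (real (Suc k))) (a k) (b k)" and "0 < t"
  obtains N where "\<And>k. N \<le> k \<Longrightarrow> strong_near V \<nu> t (a k) (b k)"
proof -
  obtain N where N: "inverse (real (Suc N)) < t" using reals_Archimedean[OF \<open>0 < t\<close>] by blast
  have "strong_near V \<nu> t (a k) (b k)" if "N \<le> k" for k
  proof (rule near_mono[OF assms(1,2) _ ab])
    have "inverse (real (Suc k)) \<le> inverse (real (Suc N))" using that by simp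
    then show "inverse (real (Suc k)) \<le> t" using N by linarith
  qed
  then show thesis using that by blast
qed

text \<open>Convergence of the cosets to \<open>W +> p\<close> yields points
  \<open>w k \<oplus> p\<close> close to selected terms \<open>s (f k)\<close>. Closeness makes
  \<open>w\<close> Cauchy in \<open>W\<close>, and its limit \<open>w0\<close> gives the limit
  \<open>w0 \<oplus> p\<close> of \<open>s\<close>.\<close>

lemma strongly_complete_extension:
  assumes W: "submodule W real_ring V" and Q: "PN_space (quot_module V W) (quot_norm \<nu>) \<tau> \<tau>s"
    and cW: "strongly_complete (V\<lparr>carrier := W\<rparr>) (restrict \<nu> W)"
    and cQ: "strongly_complete (quot_module V W) (quot_norm \<nu>)"
  shows "strongly_complete V \<nu>"
  unfolding strongly_complete_def
proof (intro allI impI, elim conjE)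
  let ?Q = "quot_module V W" and ?W = "V\<lparr>carrier := W\<rparr>"
  interpret Q: PN_space ?Q "quot_norm \<nu>" \<tau> \<tau>s by (rule Q)
  interpret W: submodule W real_ring V by fact
  fix s assume r: "range s \<subseteq> carrier V" and C: "strong_Cauchy V \<nu> s"
  have s: "s n \<in> carrier V" for n using r by auto
  have WV: "w \<in> carrier V" if "w \<in> W" for w using that W.subset by auto
  have rQ: "range (\<lambda>n. W +> s n) \<subseteq> carrier ?Q" using submodule_coset(3)[OF W s] by auto
  have "strong_near ?Q (quot_norm \<nu>) t (W +> s n) (W +> s m)"
    if "strong_near V \<nu> t (s n) (s m)" for t m n
    using strong_near_quot[OF W s s] submodule_coset(2)[OF W s] that by blast
  then have "strong_Cauchy ?Q (quot_norm \<nu>) (\<lambda>n. W +> s n)"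
    using C unfolding strong_Cauchy_iff_near by meson
  then obtain K where K: "K \<in> carrier ?Q" "strongly_convergent_to ?Q (quot_norm \<nu>) (\<lambda>n. W +> s n) K"
    using cQ rQ unfolding strongly_complete_def by blast
  then obtain p where p: "p \<in> carrier V" "K = W +> p" using quot_in[OF W] by blast
  have "\<exists>n w. k \<le> n \<and> w \<in> W \<and> strong_near V \<nu> (inverse (real (Suc k))) (w \<oplus> p) (s n)" for k
  proof -
    obtain N where N: "\<And>n. n \<ge> N \<Longrightarrow>
        strong_near ?Q (quot_norm \<nu>) (inverse (real (Suc k))) (W +> s n) (W +> p)"
      using K(2) unfolding strongly_convergent_to_iff_near[OF rQ] p
      by (metis inverse_positive_iff_positive of_nat_0_less_iff zero_less_Suc)
    \<comment> \<open>Symmetry places the representative to be chosen in \<open>W +> p\<close> and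
      keeps the term of \<open>s\<close> fixed. The index \<open>max k N\<close> also secures
      \<open>k \<le> n\<close>.\<close>
    from Q.near_sym[OF _ _ N[of "max k N"]]
    have "strong_near ?Q (quot_norm \<nu>) (inverse (real (Suc k))) (W +> p) (W +> s (max k N))"
      using submodule_coset(3)[OF W] s p by simp
    then obtain x where x: "x \<in> W +> p"
        "strong_near V \<nu> (inverse (real (Suc k))) x (s (max k N))"
      unfolding strong_near_quot[OF W p(1) s] by blast
    then obtain v where "v \<in> W" "x = v \<oplus> p" by (auto simp: a_r_coset_def')
    then show ?thesis using x(2) by (metis max.cobounded1)
  qed
  then obtain f w where f: "\<And>k. k \<le> f k" and w: "\<And>k. w k \<in> W"
    and near: "\<And>k. strong_near V \<nu> (inverse (real (Suc k))) (w k \<oplus> p) (s (f k))" by metis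
  have wp: "v \<oplus> p \<in> carrier V" if "v \<in> W" for v using WV[OF that] p by simp
  \<comment> \<open>Translation by \<open>p\<close> cancels in differences, so closeness near
    \<open>W +> p\<close> can be read inside \<open>W\<close>.\<close>
  have shift: "strong_near V \<nu> t (v \<oplus> p) (v' \<oplus> p) \<longleftrightarrow> strong_near V \<nu> t v v'"
    if "v \<in> W" "v' \<in> W" for t v v'
  proof -
    have "\<ominus> (v' \<oplus> p) = \<ominus> p \<oplus> \<ominus> v'"
      using WV[OF that(2)] p(1) by (simp add: M.minus_add M.a_comm)
    then have "(v \<oplus> p) \<ominus> (v' \<oplus> p) = v \<ominus> v'"
      using WV[OF that(1)] WV[OF that(2)] p(1) by (simp add: M.minus_eq M.a_assoc M.r_neg2)
    then show ?thesis by (simp add: strong_near_def)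
  qed
  have rW: "range w \<subseteq> carrier ?W" using w by auto
  have "strong_Cauchy ?W (restrict \<nu> W) w"
    unfolding strong_Cauchy_iff_near
  proof (intro allI impI)
    fix t :: real assume "0 < t"
    then obtain u where u: "0 < u" and tu: "\<And>p q r. p \<in> carrier V \<Longrightarrow> q \<in> carrier V \<Longrightarrow>
        r \<in> carrier V \<Longrightarrow> strong_near V \<nu> u p q \<Longrightarrow> strong_near V \<nu> u q r \<Longrightarrow>
        strong_near V \<nu> t p r" by (rule near_trans) blast
    \<comment> \<open>The chain from \<open>w n \<oplus> p\<close> through \<open>s (f n)\<close>
      and \<open>s (f m)\<close> to \<open>w m \<oplus> p\<close> has three links and so takes two
      compositions; \<open>v \<le> u\<close> adapts the last link.\<close>
    from u obtain v where v: "0 < v" "v \<le> u" and uv: "\<And>p q r. p \<in> carrier V \<Longrightarrow> q \<in> carrier V \<Longrightarrow>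
        r \<in> carrier V \<Longrightarrow> strong_near V \<nu> v p q \<Longrightarrow> strong_near V \<nu> v q r \<Longrightarrow>
        strong_near V \<nu> u p r" by (rule near_trans) blast
    obtain N where N: "\<And>m n. m > N \<Longrightarrow> n > N \<Longrightarrow> strong_near V \<nu> v (s n) (s m)"
      using C v unfolding strong_Cauchy_iff_near by blast
    obtain M where M: "\<And>k. M \<le> k \<Longrightarrow> strong_near V \<nu> v (w k \<oplus> p) (s (f k))"
      using near_perturb[OF wp[OF w] s near v(1)] by blast
    have "strong_near ?W (restrict \<nu> W) t (w n) (w m)" if "m > max M N" "n > max M N" for m n
    proof -
      have "strong_near V \<nu> v (s (f n)) (s (f m))"
        using N[of "f m" "f n"] f[of m] f[of n] that by linarith
      then have "strong_near V \<nu> u (w n \<oplus> p) (s (f m))"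
        using uv[OF wp[OF w] s s M] that by auto
      moreover have "strong_near V \<nu> u (s (f m)) (w m \<oplus> p)"
        using near_sym[OF wp[OF w] s M] near_mono[OF s wp[OF w] v(2)] that by simp
      ultimately have "strong_near V \<nu> t (w n \<oplus> p) (w m \<oplus> p)"
        using tu[OF wp[OF w] s wp[OF w]] by blast
      then show ?thesis by (simp add: shift w strong_near_subspace[OF W])
    qed
    then show "\<exists>N. \<forall>m>N. \<forall>n>N. strong_near ?W (restrict \<nu> W) t (w n) (w m)" by blast
  qed
  then obtain w0 where w0: "w0 \<in> W" "strongly_convergent_to ?W (restrict \<nu> W) w w0"
    using cW rW unfolding strongly_complete_def by (auto 4 4)
  have lim: "\<forall>t>0. \<exists>N. \<forall>n\<ge>N. strong_near V \<nu> t (w n \<oplus> p) (w0 \<oplus> p)"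
    using w0(2) unfolding strongly_convergent_to_iff_near[OF rW]
    by (simp add: shift w w0(1) strong_near_subspace[OF W])
  have rf: "range (s \<circ> f) \<subseteq> carrier V" using s by auto
  have "strongly_convergent_to V \<nu> (s \<circ> f) (w0 \<oplus> p)"
    unfolding strongly_convergent_to_iff_near[OF rf]
  proof (intro allI impI)
    fix t :: real assume "0 < t"
    then obtain u where u: "0 < u" and tu: "\<And>p q r. p \<in> carrier V \<Longrightarrow> q \<in> carrier V \<Longrightarrow>
        r \<in> carrier V \<Longrightarrow> strong_near V \<nu> u p q \<Longrightarrow> strong_near V \<nu> u q r \<Longrightarrow>
        strong_near V \<nu> t p r" by (rule near_trans) blast
    obtain M where M: "\<And>k. M \<le> k \<Longrightarrow> strong_near V \<nu> u (w k \<oplus> p) (s (f k))"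
      using near_perturb[OF wp[OF w] s near u] by blast
    obtain N where N: "\<And>n. n \<ge> N \<Longrightarrow> strong_near V \<nu> u (w n \<oplus> p) (w0 \<oplus> p)"
      using lim u by blast
    have "strong_near V \<nu> t ((s \<circ> f) n) (w0 \<oplus> p)" if "n \<ge> max M N" for n
      using tu[OF s wp[OF w] wp[OF w0(1)] near_sym[OF wp[OF w] s M] N] that by simp
    then show "\<exists>N. \<forall>n\<ge>N. strong_near V \<nu> t ((s \<circ> f) n) (w0 \<oplus> p)" by blast
  qed
  then have "strongly_convergent_to V \<nu> s (w0 \<oplus> p)"
    by (intro strong_Cauchy_subseq_convergent[OF r C wp[OF w0(1)] f])
  then show "\<exists>q\<in>carrier V. strongly_convergent_to V \<nu> s q" using wp[OF w0(1)] by blast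
qed

end

theorem theorem4p3:
  fixes V :: "(real, 'v, 'm) module_scheme"
    and \<nu> :: "'v \<Rightarrow> ereal \<Rightarrow> real"
    and \<tau> \<tau>s :: "(ereal \<Rightarrow> real) \<Rightarrow> (ereal \<Rightarrow> real) \<Rightarrow> (ereal \<Rightarrow> real)"
    and W :: "'v set"
  assumes "PN_space V \<nu> \<tau> \<tau>s"
    and "sup_continuous_tf \<tau>"
    and "sup_continuous_tf \<tau>s"
    and "submodule W real_ring V"
    and "closedin (strong_topology V \<nu>) W"
  shows "(strongly_complete V \<nu> \<and> strongly_complete (V\<lparr>carrier := W\<rparr>) (restrict \<nu> W) \<longrightarrow>
            strongly_complete (quot_module V W) (quot_norm \<nu>)) \<and>
         (strongly_complete V \<nu> \<and> strongly_complete (quot_module V W) (quot_norm \<nu>) \<longrightarrow>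
            strongly_complete (V\<lparr>carrier := W\<rparr>) (restrict \<nu> W)) \<and>
         (strongly_complete (V\<lparr>carrier := W\<rparr>) (restrict \<nu> W) \<and>
            strongly_complete (quot_module V W) (quot_norm \<nu>) \<longrightarrow>
            strongly_complete V \<nu>)"
proof -
  interpret PN_space V \<nu> \<tau> \<tau>s by fact
  \<comment> \<open>Sup-continuity of \<open>\<tau>\<close> provides N3 for the quotient norm, and
    closedness of \<open>W\<close> provides N1.\<close>
  have "PN_space (quot_module V W) (quot_norm \<nu>) \<tau> \<tau>s" using assms(4,5,2) by (rule quot_PN)
  then show ?thesis
    using strongly_complete_subspace strongly_complete_quot strongly_complete_extension assms(4,5)
    by blast
qed

end
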